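(* Let $k\ge 1$, $n=2^k-1$, let $B\in\mathbb{R}^{m\times m}$ be a symmetric positive definite tridiagonal matrix, and let $\mathcal{R}_n\in\mathbb{R}^{n\times n}$ be a symmetric positive definite tridiagonal matrix all of whose subdiagonal entries are non-zero. For every $r=0,1,\dots,k-1$ and $i=2^r,2\cdot2^r,\dots,(2^{k-r}-1)\cdot2^r$, the zeros of the matrix polynomial $B_i^{(r)}$ (defined recursively in the context from $B$ and the entries of $\mathcal{R}_n$) are real and simple.
   Context: Write $b_1,\dots,b_n$ for the diagonal entries of $\mathcal{R}_n$, $a_2,\dots,a_n$ for its subdiagonal entries ($a_i$ in position $(i,i-1)$) and $c_1,\dots,c_{n-1}$ for its superdiagonal entries ($c_i$ in position $(i,i+1)$; by symmetry $c_i=a_{i+1}$). Set $a_1=0$, $c_n=0$, and $$\alpha_i^{(s)}=\prod_{j=i-2^s+1}^{i}a_j,\qquad \gamma_i^{(s)}=\prod_{j=i}^{i+2^s-1}c_j .$$ Define $B_i^{(-1)}=I$ (for every index, including fractional ones that occur when $r=1$), $B_i^{(0)}=B+b_iI$ for $i=1,\dots,n$, and, for $r=1,\dots,k-1$ and $i=2^r,2\cdot2^r,\dots,(2^{k-r}-1)\cdot2^r$, $$B_i^{(r)}=\big(\mathcal{D}_i^{(r)}\big)^{-1}\Big(\alpha_i^{(r-1)}\gamma_{i-2^{r-1}}^{(r-1)}B_{i+2^{r-2}}^{(r-2)}B_{i-3\cdot2^{r-2}}^{(r-2)}B_{i+2^{r-1}}^{(r-1)}-B_{i-2^{r-1}}^{(r-1)}B_i^{(r-1)}B_{i+2^{r-1}}^{(r-1)}+\alpha_{i+2^{r-1}}^{(r-1)}\gamma_i^{(r-1)}B_{i-2^{r-2}}^{(r-2)}B_{i+3\cdot2^{r-2}}^{(r-2)}B_{i-2^{r-1}}^{(r-1)}\Big),$$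 where $\mathcal{D}_i^{(r)}=B_{i-2^{r-2}}^{(r-2)}B_{i+2^{r-2}}^{(r-2)}$. Convention: $B_i^{(r)}$ is a polynomial in $B$, and its zeros mean the zeros of the corresponding scalar polynomial, obtained from the same recursion with $B$ replaced by an indeterminate $x$ and $I$ by $1$, multiplication by $(\mathcal{D}_i^{(r)})^{-1}$ meaning division in $\mathbb{R}(x)$ (these divisions are exact, so that one obtains polynomials). *)

theory Defs
  imports
    Jordan_Normal_Form.Matrix
    "HOL-Computational_Algebra.Polynomial_Factorial"
    Complex_Main
begin

definition tridiagonal_mat :: "'a :: zero mat \<Rightarrow> bool" where
  "tridiagonal_mat A \<longleftrightarrow>
     (\<forall>i < dim_row A. \<forall>j < dim_col A. i + 1 < j \<or> j + 1 < i \<longrightarrow> A $$ (i, j) = 0)"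

definition symmetric_positive_definite :: "real mat \<Rightarrow> bool" where
  "symmetric_positive_definite A \<longleftrightarrow>
     square_mat A \<and> A\<^sup>T = A \<and>
     (\<forall>v \<in> carrier_vec (dim_row A). v \<noteq> 0\<^sub>v (dim_row A) \<longrightarrow> v \<bullet> (A *\<^sub>v v) > 0)"

text \<open>
  The entries \<open>b\<^sub>i\<close>, \<open>a\<^sub>i\<close>, \<open>c\<^sub>i\<close> are indexed by \<open>1, \<dots>, n\<close>, whereas matrix positions start at 0;
  \<open>a\<^sub>1 = 0\<close> and \<open>c\<^sub>n = 0\<close>.
\<close>

definition diag_entry :: "real mat \<Rightarrow> nat \<Rightarrow> real" where
  "diag_entry R i = R $$ (i - 1, i - 1)"

definition subdiag_entry :: "real mat \<Rightarrow> nat \<Rightarrow> real" where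
  "subdiag_entry R i = (if i = 1 then 0 else R $$ (i - 1, i - 2))"

definition superdiag_entry :: "real mat \<Rightarrow> nat \<Rightarrow> real" where
  "superdiag_entry R i = (if i = dim_row R then 0 else R $$ (i - 1, i))"

definition alpha :: "real mat \<Rightarrow> nat \<Rightarrow> nat \<Rightarrow> real" where
  "alpha R s i = (\<Prod>j = i + 1 - 2 ^ s..i. subdiag_entry R j)"

definition gamma :: "real mat \<Rightarrow> nat \<Rightarrow> nat \<Rightarrow> real" where
  "gamma R s i = (\<Prod>j = i..i + 2 ^ s - 1. superdiag_entry R j)"

abbreviation const_fract :: "real \<Rightarrow> real poly fract" where
  "const_fract c \<equiv> to_fract [:c:]"

text \<open>
  The recursion in \<open>\<real>(x)\<close>, with the superscript shifted by one: \<open>Brec R (r + 1) i\<close> is the scalar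
  version of \<open>B\<^sub>i\<close> with superscript \<open>r\<close>, for \<open>r \<ge> -1\<close>. In the third equation
  \<open>r = s + 1\<close>, \<open>h = 2 ^ (r - 1)\<close> and \<open>q = 2 ^ (r - 2)\<close>. For \<open>r = 1\<close> the true
  value of \<open>q\<close> is \<open>1/2\<close>; rounding it is harmless, since \<open>q\<close> only enters the index of
  \<open>Brec R 0\<close>, which is constantly 1. No subtraction in an index truncates
  for \<open>r \<ge> 2\<close> and \<open>i\<close> a positive multiple of \<open>2 ^ r\<close>.
\<close>

fun Brec :: "real mat \<Rightarrow> nat \<Rightarrow> nat \<Rightarrow> real poly fract" where
  "Brec R 0 i = 1"
| "Brec R (Suc 0) i = to_fract [:0, 1:] + const_fract (diag_entry R i)"
| "Brec R (Suc (Suc s)) i =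
     (let h = 2 ^ s; q = h div 2 in
       (  const_fract (alpha R s i * gamma R s (i - h))
            * Brec R s (i + q) * Brec R s (i - 3 * q) * Brec R (Suc s) (i + h)
        - Brec R (Suc s) (i - h) * Brec R (Suc s) i * Brec R (Suc s) (i + h)
        + const_fract (alpha R s (i + h) * gamma R s i)
            * Brec R s (i - q) * Brec R s (i + 3 * q) * Brec R (Suc s) (i - h))
       / (Brec R s (i - q) * Brec R s (i + q)))"

definition B_scalar :: "real mat \<Rightarrow> nat \<Rightarrow> nat \<Rightarrow> real poly fract" where
  "B_scalar R r i = Brec R (r + 1) i"

text \<open>Zeros are taken over the complex numbers; the zero polynomial does not qualify.\<close>

definition zeros_real_simple :: "real poly \<Rightarrow> bool" where
  "zeros_real_simple p \<longleftrightarrow>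
     (let P = map_poly complex_of_real p in
        P \<noteq> 0 \<and> (\<forall>z. poly P z = 0 \<longrightarrow> z \<in> \<real> \<and> order z P = 1))"

end

theory Submission
  imports Defs Jordan_Normal_Form.Char_Poly
begin

text \<open>
  Up to the sign \<open>(-1)\<^sup>r\<close>, the polynomial \<open>B\<^sub>i\<close> with superscript \<open>r\<close> is the determinant of \<open>x I + T\<close>,
  where \<open>T\<close> is the principal submatrix of the tridiagonal matrix on the indices
  \<open>i - 2\<^sup>r + 1, \<dots>, i + 2\<^sup>r - 1\<close>. Such determinants are continuants, and the recursion is
  a consequence of Euler's identities for continuants. With \<open>k\<^sub>j\<close> the leading principal minors
  of \<open>x I + T\<close>, the three-term recurrence with positive weights makes \<open>Im (k\<^sub>j\<^sub>+\<^sub>1 \<cdot> cnj k\<^sub>j)\<close> have the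
  sign of \<open>Im x\<close>, so that all zeros are real, and makes \<open>k\<^sub>j\<^sub>+\<^sub>1' k\<^sub>j - k\<^sub>j\<^sub>+\<^sub>1 k\<^sub>j'\<close> positive at real \<open>x\<close>,
  so that they are simple.
\<close>

section \<open>Continuants and Euler's identities\<close>

text \<open>
  The determinant of the tridiagonal matrix of size \<open>l\<close> with diagonal \<open>d p, \<dots>, d (p + l - 1)\<close>,
  where \<open>w j\<close> is the product of the two off-diagonal entries linking \<open>j - 1\<close> and \<open>j\<close>.
\<close>

fun continuant :: "(nat \<Rightarrow> 'a::comm_ring_1) \<Rightarrow> (nat \<Rightarrow> 'a) \<Rightarrow> nat \<Rightarrow> nat \<Rightarrow> 'a" where
  "continuant d w p 0 = 1"
| "continuant d w p (Suc 0) = d p"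
| "continuant d w p (Suc (Suc l)) =
     d (p + l + 1) * continuant d w p (Suc l) - w (p + l + 1) * continuant d w p l"

text \<open>Both sides, as functions of \<open>c\<close>, obey the same three-term recurrence at the
  right end, so agreement at two lengths suffices.\<close>

lemma continuant_split:
  "continuant d w p (Suc a + Suc c) =
     continuant d w p (Suc a) * continuant d w (p + a + 1) (Suc c)
     - w (p + a + 1) * continuant d w p a * continuant d w (p + a + 2) c"
proof (induction c rule: induct_nat_012)
  case 0
  show ?case by (simp add: algebra_simps)
next
  case 1
  show ?case by (simp add: algebra_simps)
next
  case (ge2 c)
  have full: "continuant d w p (Suc a + Suc (Suc (Suc c))) =
      d (p + a + c + 3) * continuant d w p (Suc a + Suc (Suc c))
      - w (p + a + c + 3) * continuant d w p (Suc a + Suc c)"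
    using continuant.simps(3)[of d w p "Suc a + Suc c"]
    by (simp add: eval_nat_numeral add_ac del: continuant.simps(3))
  have right: "continuant d w (p + a + 1) (Suc (Suc (Suc c))) =
      d (p + a + c + 3) * continuant d w (p + a + 1) (Suc (Suc c))
      - w (p + a + c + 3) * continuant d w (p + a + 1) (Suc c)"
    using continuant.simps(3)[of d w "p + a + 1" "Suc c"]
    by (simp add: eval_nat_numeral add_ac del: continuant.simps(3))
  have right': "continuant d w (p + a + 2) (Suc (Suc c)) =
      d (p + a + c + 3) * continuant d w (p + a + 2) (Suc c)
      - w (p + a + c + 3) * continuant d w (p + a + 2) c"
    using continuant.simps(3)[of d w "p + a + 2" c]
    by (simp add: eval_nat_numeral add_ac del: continuant.simps(3))
  show ?case
    unfolding full right right' ge2 by (simp only: algebra_simps)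
qed

lemma continuant_Suc_Suc_left:
  "continuant d w p (Suc (Suc c)) =
     d p * continuant d w (Suc p) (Suc c) - w (Suc p) * continuant d w (Suc (Suc p)) c"
  using continuant_split[of d w p 0 c] by simp

text \<open>The continuants starting at \<open>p\<close> and at \<open>p + Suc g\<close> solve the
  same second-order recurrence in their right end; their Casoratian gains one factor
  \<open>w\<close> per step.\<close>

lemma continuant_Euler_right:
  "continuant d w p (Suc g + t) * continuant d w (p + Suc g) (Suc t)
     - continuant d w p (Suc (Suc g) + t) * continuant d w (p + Suc g) t
   = continuant d w p g * (\<Prod>j = p + Suc g..p + Suc g + t. w j)"
proof (induction t)
  case 0
  show ?case by (simp add: algebra_simps)
next
  case (Suc t)
  have "continuant d w p (Suc g + Suc t) * continuant d w (p + Suc g) (Suc (Suc t))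
      - continuant d w p (Suc (Suc g) + Suc t) * continuant d w (p + Suc g) (Suc t)
      = w (p + Suc g + Suc t) *
       (continuant d w p (Suc g + t) * continuant d w (p + Suc g) (Suc t)
        - continuant d w p (Suc (Suc g) + t) * continuant d w (p + Suc g) t)"
    by (simp add: algebra_simps)
  then show ?case
    unfolding Suc by (simp add: algebra_simps)
qed

text \<open>The mirror image: the Casoratian is taken in the left end, which moves during the
  induction, so \<open>p\<close> must vary.\<close>

lemma continuant_Euler_left:
  "continuant d w (Suc p) (Suc (t + g)) * continuant d w p (Suc t)
     - continuant d w p (Suc (Suc (t + g))) * continuant d w (Suc p) t
   = continuant d w (p + t + 2) g * (\<Prod>j = Suc p..Suc p + t. w j)"
proof (induction t arbitrary: p)
  case 0
  show ?case unfolding continuant_Suc_Suc_left by (simp add: algebra_simps)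
next
  case (Suc t)
  have "continuant d w (Suc p) (Suc (Suc t + g)) * continuant d w p (Suc (Suc t))
      - continuant d w p (Suc (Suc (Suc t + g))) * continuant d w (Suc p) (Suc t)
      = w (Suc p) *
       (continuant d w (Suc (Suc p)) (Suc (t + g)) * continuant d w (Suc p) (Suc t)
        - continuant d w (Suc p) (Suc (Suc (t + g))) * continuant d w (Suc (Suc p)) t)"
    unfolding continuant_Suc_Suc_left[of d w p] by (simp add: algebra_simps del: continuant.simps(3))
  also have "\<dots> = continuant d w (p + Suc t + 2) g * (w (Suc p) * (\<Prod>j = Suc (Suc p)..Suc (Suc p) + t. w j))"
    unfolding Suc by (simp add: algebra_simps)
  also have "w (Suc p) * (\<Prod>j = Suc (Suc p)..Suc (Suc p) + t. w j) = (\<Prod>j = Suc p..Suc p + Suc t. w j)"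
    by (subst (2) prod.atLeast_Suc_atMost) auto
  finally show ?case .
qed

text \<open>
  The index window of length \<open>4h - 1\<close> is centred at \<open>i = p + 2h - 1\<close>, with \<open>h = u + 1\<close>. Both sides
  are expanded at \<open>i\<close>; the differences that remain are those of Euler's identities.
\<close>

lemma continuant_doubling:
  assumes "i = p + 2 * u + 1"
  shows "continuant d w p (4 * u + 3) * continuant d w (p + u + 1) u * continuant d w (i + 1) u
    = continuant d w p (2 * u + 1) * continuant d w (p + u + 1) (2 * u + 1)
        * continuant d w (i + 1) (2 * u + 1)
      - (\<Prod>j = i - u..i. w j)
        * continuant d w (i + 1) u * continuant d w p u * continuant d w (i + 1) (2 * u + 1)
      - (\<Prod>j = i + 1..i + 1 + u. w j)
        * continuant d w (p + u + 1) u * continuant d w (i + u + 2) u * continuant d w p (2 * u + 1)"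
proof (cases u)
  case 0
  then show ?thesis
    using assms by (simp add: eval_nat_numeral algebra_simps)
next
  \<comment> \<open>\<open>v = u - 1\<close> is the length of the part of the middle window beyond
    \<open>i + 1\<close>.\<close>
  case (Suc v)
  let ?K = "continuant d w"
  have i: "i = p + 2 * v + 3" using assms Suc by simp
  \<comment> \<open>The full and the middle window are both cut between \<open>i\<close> and
    \<open>i + 1\<close>.\<close>
  have full: "?K p (4 * u + 3) = ?K p (2 * u + 2) * ?K (i + 1) (2 * u + 1)
       - w (i + 1) * ?K p (2 * u + 1) * ?K (i + 2) (2 * u)"
    using continuant_split[of d w p "2 * u + 1" "2 * u"]
    by (simp add: assms numeral_3_eq_3 del: continuant.simps(3))
  have mid: "?K (p + u + 1) (2 * u + 1) = ?K (p + u + 1) (u + 1) * ?K (i + 1) u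
       - w (i + 1) * ?K (p + u + 1) u * ?K (i + 2) v"
    using continuant_split[of d w "p + u + 1" u v]
    by (simp add: assms Suc mult_2 add_ac del: continuant.simps(3))
  have Euler_right: "?K p (2 * u + 1) * ?K (p + u + 1) (u + 1) - ?K p (2 * u + 2) * ?K (p + u + 1) u
       = ?K p u * (\<Prod>j = i - u..i. w j)"
    using continuant_Euler_right[of d w p u u]
    by (simp add: assms mult_2 add.assoc del: continuant.simps(3))
  have Euler_left: "?K (i + 2) (2 * u) * ?K (i + 1) u - ?K (i + 1) (2 * u + 1) * ?K (i + 2) v
       = ?K (i + u + 2) u * (\<Prod>j = i + 2..i + 1 + u. w j)"
    using continuant_Euler_left[of d w "i + 1" v u]
    by (simp add: Suc mult_2 del: continuant.simps(3))
  \<comment> \<open>Trading the weight products for Euler differences leaves a plain ring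
    identity.\<close>
  have right: "(\<Prod>j = i - u..i. w j) * ?K (i + 1) u * ?K p u * ?K (i + 1) (2 * u + 1)
      = (?K p (2 * u + 1) * ?K (p + u + 1) (u + 1) - ?K p (2 * u + 2) * ?K (p + u + 1) u)
        * ?K (i + 1) u * ?K (i + 1) (2 * u + 1)"
    unfolding Euler_right by (simp only: ac_simps)
  have prod: "(\<Prod>j = i + 1..i + 1 + u. w j) = w (i + 1) * (\<Prod>j = i + 2..i + 1 + u. w j)"
    by (subst prod.atLeast_Suc_atMost) auto
  have left: "(\<Prod>j = i + 1..i + 1 + u. w j) * ?K (p + u + 1) u * ?K (i + u + 2) u * ?K p (2 * u + 1)
      = w (i + 1) * (?K (i + 2) (2 * u) * ?K (i + 1) u - ?K (i + 1) (2 * u + 1) * ?K (i + 2) v)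
        * ?K (p + u + 1) u * ?K p (2 * u + 1)"
    unfolding Euler_left prod by (simp only: ac_simps)
  show ?thesis
    unfolding full mid right left by (simp only: algebra_simps)
qed

section \<open>The recursion solved by principal minors\<close>

definition principal_minor :: "real mat \<Rightarrow> nat \<Rightarrow> nat \<Rightarrow> real poly" where
  "principal_minor R = continuant (\<lambda>j. [:diag_entry R j, 1:])
     (\<lambda>j. [:subdiag_entry R j * superdiag_entry R (j - 1):])"

text \<open>Monicity rules out the zero polynomial, so the divisions in the recursion can be
  cancelled.\<close>

lemma coeff_principal_minor:
  "degree (principal_minor R p l) \<le> l \<and> coeff (principal_minor R p l) l = 1"
proof (induction l rule: induct_nat_012)
  case (ge2 l)
  then have "coeff (principal_minor R p l) (Suc (Suc l)) = 0"
    and "coeff (principal_minor R p (Suc l)) (Suc (Suc l)) = 0"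
    by (auto intro: coeff_eq_0)
  with ge2 show ?case
    by (auto simp: principal_minor_def intro!: degree_diff_le degree_add_le
        order.trans[OF degree_smult_le] order.trans[OF degree_pCons_le])
qed (auto simp: principal_minor_def)

lemma principal_minor_nonzero: "principal_minor R p l \<noteq> 0"
  using coeff_principal_minor[of R p l] by auto

lemma const_poly_prod: "[:\<Prod>j\<in>A. f j:] = (\<Prod>j\<in>A. [:f j :: 'a :: comm_semiring_1:])"
proof (induction A rule: infinite_finite_induct)
  case (insert x A)
  from insert.hyps have "[:\<Prod>j\<in>insert x A. f j:] = [:f x:] * [:\<Prod>j\<in>A. f j:]"
    by (simp add: mult.commute)
  with insert show ?case
    by (simp only: prod.insert[OF insert.hyps])
qed (simp_all add: one_pCons)

text \<open>Shifting the index of \<open>gamma\<close> by one pairs the two off-diagonal entries of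
  each link, giving the weight products of Euler's identities.\<close>

lemma alpha_gamma:
  assumes "2 ^ s \<le> i"
  shows "[:alpha R s i * gamma R s (i - 2 ^ s):] =
    (\<Prod>j = i + 1 - 2 ^ s..i. [:subdiag_entry R j * superdiag_entry R (j - 1):])"
proof -
  have "gamma R s (i - 2 ^ s) = (\<Prod>j = i - 2 ^ s..i - 1. superdiag_entry R j)"
    unfolding gamma_def using assms by simp
  also have "\<dots> = (\<Prod>j = i + 1 - 2 ^ s..i. superdiag_entry R (j - 1))"
  proof -
    have "0 < (2::nat) ^ s" by simp
    with assms have "0 < i" by linarith
    with assms show ?thesis
      by (intro prod.reindex_bij_witness[of _ "\<lambda>j. j - 1" Suc]) auto
  qed
  finally have "alpha R s i * gamma R s (i - 2 ^ s) =
      (\<Prod>j = i + 1 - 2 ^ s..i. subdiag_entry R j * superdiag_entry R (j - 1))"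
    by (simp add: alpha_def prod.distrib)
  then show ?thesis by (simp only: const_poly_prod)
qed

text \<open>\<open>continuant_doubling\<close> is the recursion up to signs. The recursion reaches
  two levels down, hence strong induction; the bound on \<open>i\<close> keeps index subtractions
  from truncating.\<close>

lemma Brec_eq_principal_minor:
  "2 ^ r \<le> i \<Longrightarrow> Brec R (Suc r) i =
     to_fract ((-1) ^ r * principal_minor R (i + 1 - 2 ^ r) (2 ^ Suc r - 1))"
proof (induction r arbitrary: i rule: less_induct)
  case (less r)
  show ?case
  proof (cases r)
    case 0
    then show ?thesis
      by (simp add: principal_minor_def flip: to_fract_add)
  next
    case (Suc s)
    let ?K = "principal_minor R"
    \<comment> \<open>With this \<open>u\<close>, the windows at the three successive levels have
      lengths \<open>u\<close>, \<open>2 * u + 1\<close> and \<open>4 * u + 3\<close>.\<close>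
    define u :: nat where "u = 2 ^ s - 1"
    define p where "p = i - 2 * u - 1"
    define q :: nat where "q = 2 ^ s div 2"
    have h: "2 ^ s = u + 1" by (simp add: u_def)
    have i: "i = p + 2 * u + 1" and "p > 0" using less.prems by (simp_all add: p_def Suc h)
    have mid: "Brec R (Suc s) j = to_fract ((-1) ^ s * ?K (j - u) (2 * u + 1))" if "u + 1 \<le> j" for j
      using less.IH[of s j] that by (simp add: Suc h)
    \<comment> \<open>\<open>e\<close> is \<open>(-1)\<close> to the power \<open>s - 1\<close>, except that \<open>e = 1\<close> for \<open>s = 0\<close>.\<close>
    have small: "\<exists>e. e * e = 1 \<and> (\<forall>j \<ge> 2 * q. Brec R s (j - q) = to_fract (e * ?K (j - u) u)
         \<and> Brec R s (j + q) = to_fract (e * ?K (j + 1) u)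
         \<and> Brec R s (j + 3 * q) = to_fract (e * ?K (j + u + 2) u))
         \<and> (\<forall>j \<ge> 4 * q. Brec R s (j - 3 * q) = to_fract (e * ?K (j - 2 * u - 1) u))"
    proof (cases s)
      case 0
      then show ?thesis by (intro exI[of _ 1]) (simp add: u_def principal_minor_def)
    next
      case (Suc t)
      have q: "q = 2 ^ t" and u: "u = 2 * q - 1" and "q > 0" by (simp_all add: q_def u_def Suc)
      have IH: "Brec R s j = to_fract ((-1) ^ t * ?K (j + 1 - q) u)" if "q \<le> j" for j
        using less.IH[of t j] that by (simp add: Suc \<open>r = Suc s\<close> q u)
      show ?thesis
      proof (intro exI[of _ "(-1) ^ t"] conjI allI impI)
        show "(- 1) ^ t * (- 1) ^ t = (1::real poly)"
          by (simp flip: power_mult_distrib)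
      qed (use \<open>q > 0\<close> u in \<open>auto simp: IH intro!: arg_cong2[of _ _ _ _ ?K]\<close>)
    qed
    then obtain e where e: "e * e = 1"
      and sm: "\<And>j. j \<ge> 2 * q \<Longrightarrow> Brec R s (j - q) = to_fract (e * ?K (j - u) u)"
      and sp: "\<And>j. j \<ge> 2 * q \<Longrightarrow> Brec R s (j + q) = to_fract (e * ?K (j + 1) u)"
      and sp3: "\<And>j. j \<ge> 2 * q \<Longrightarrow> Brec R s (j + 3 * q) = to_fract (e * ?K (j + u + 2) u)"
      and sm3: "\<And>j. j \<ge> 4 * q \<Longrightarrow> Brec R s (j - 3 * q) = to_fract (e * ?K (j - 2 * u - 1) u)"
      by blast
    have "2 * q \<le> 2 ^ s" by (simp add: q_def)
    then have iq: "4 * q \<le> i" "2 * q \<le> i" using h i \<open>p > 0\<close> by auto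
    define P1 where "P1 = [:alpha R s i * gamma R s (i - (u + 1)):]"
    define P2 where "P2 = [:alpha R s (i + (u + 1)) * gamma R s i:]"
    define L C M X Y E F
      where "L = ?K p (2 * u + 1)" and "C = ?K (i + 1) (2 * u + 1)"
        and "M = ?K (p + u + 1) (2 * u + 1)" and "X = ?K (p + u + 1) u" and "Y = ?K (i + 1) u"
        and "E = ?K p u" and "F = ?K (i + u + 2) u"
    have P1: "P1 = (\<Prod>j = i - u..i. [:subdiag_entry R j * superdiag_entry R (j - 1):])"
      using alpha_gamma[of s i R] i by (simp add: P1_def h)
    have P2: "P2 = (\<Prod>j = i + 1..i + 1 + u. [:subdiag_entry R j * superdiag_entry R (j - 1):])"
      using alpha_gamma[of s "i + 2 ^ s" R] by (simp add: P2_def h)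
    have key: "?K p (4 * u + 3) * X * Y = L * M * C - P1 * Y * E * C - P2 * X * F * L"
      unfolding P1 P2 L_def C_def M_def X_def Y_def E_def F_def principal_minor_def
      by (rule continuant_doubling) (rule i)
    have nz: "X \<noteq> 0" "Y \<noteq> 0" "e \<noteq> 0"
      using e by (auto simp: X_def Y_def principal_minor_nonzero)
    have ss: "(-1) ^ s * (-1) ^ s = (1::real poly)"
      by (simp flip: power_mult_distrib)
    have vals: "Brec R s (i - q) = to_fract (e * X)" "Brec R s (i + q) = to_fract (e * Y)"
        "Brec R s (i - 3 * q) = to_fract (e * E)" "Brec R s (i + 3 * q) = to_fract (e * F)"
      using sm[of i] sp[of i] sp3[of i] sm3[of i] iq i
      unfolding X_def Y_def E_def F_def by (simp_all add: ac_simps)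
    have vals': "Brec R (Suc s) (i - (u + 1)) = to_fract ((-1) ^ s * L)"
        "Brec R (Suc s) i = to_fract ((-1) ^ s * M)"
        "Brec R (Suc s) (i + (u + 1)) = to_fract ((-1) ^ s * C)"
      using mid[of "i - (u + 1)"] mid[of i] mid[of "i + (u + 1)"] i \<open>p > 0\<close>
      unfolding L_def M_def C_def by (simp_all add: ac_simps mult_2)
    let ?N = "P1 * (e * Y) * (e * E) * ((-1) ^ s * C)
         - ((-1) ^ s * L) * ((-1) ^ s * M) * ((-1) ^ s * C)
         + P2 * (e * X) * (e * F) * ((-1) ^ s * L)"
    have "Brec R (Suc r) i = to_fract ?N / to_fract ((e * X) * (e * Y))"
      unfolding Suc Brec.simps Let_def q_def[symmetric]
      unfolding h vals vals' P1_def P2_def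
      by (simp only: to_fract_mult to_fract_add to_fract_diff)
    \<comment> \<open>Once the squared signs become 1, the bracket is the negative of the right-hand
      side of \<open>key\<close>; this turns the exponent \<open>s\<close> into
      \<open>r\<close>.\<close>
    also have "?N = (-1) ^ s * ((e * e) * (P1 * Y * E * C + P2 * X * F * L)
        - ((-1) ^ s * (-1) ^ s) * (L * M * C))"
      by (simp only: algebra_simps)
    also have "\<dots> = (-1) ^ r * (e * e) * (?K p (4 * u + 3) * X * Y)"
      unfolding e ss key Suc by (simp add: algebra_simps)
    also have "\<dots> = ((-1) ^ r * ?K p (4 * u + 3)) * ((e * X) * (e * Y))"
      by (simp only: ac_simps)
    also have "to_fract \<dots> / to_fract ((e * X) * (e * Y)) = to_fract ((-1) ^ r * ?K p (4 * u + 3))"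
      using nz by (simp add: to_fract_mult)
    also have "p = i + 1 - 2 ^ r" using i by (simp add: Suc h)
    also have "4 * u + 3 = 2 ^ Suc r - 1" by (simp add: Suc h)
    finally show ?thesis .
  qed
qed

section \<open>Real and simple zeros\<close>

text \<open>The real diagonal entry drops out of the imaginary part. The factor \<open>Im z\<close>
  treats both half-planes at once.\<close>

lemma Im_continuant_pos:
  fixes d w :: "nat \<Rightarrow> real" and z :: complex
  assumes "Im z \<noteq> 0" and "\<And>j. p < j \<Longrightarrow> j \<le> p + l \<Longrightarrow> w j > 0"
  defines "K \<equiv> continuant (\<lambda>j. z + of_real (d j)) (\<lambda>j. of_real (w j)) p"
  shows "Im z * Im (K (Suc l) * cnj (K l)) > 0"
  using assms(2)
proof (induction l)
  case 0
  then show ?case using assms(1) by (auto simp: K_def zero_less_mult_iff linorder_neq_iff)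
next
  case (Suc l)
  define b c where "b = d (p + l + 1)" and "c = w (p + l + 1)"
  have rec: "K (Suc (Suc l)) = (z + of_real b) * K (Suc l) - of_real c * K l"
    by (simp add: K_def b_def c_def)
  have "Im (K (Suc (Suc l)) * cnj (K (Suc l))) =
      Im z * (cmod (K (Suc l)))\<^sup>2 + c * Im (K (Suc l) * cnj (K l))"
    unfolding rec cmod_power2 by (simp add: algebra_simps power2_eq_square)
  then have "Im z * Im (K (Suc (Suc l)) * cnj (K (Suc l))) =
      (Im z * cmod (K (Suc l)))\<^sup>2 + c * (Im z * Im (K (Suc l) * cnj (K l)))"
    by (simp only: algebra_simps power2_eq_square)
  moreover have "c * (Im z * Im (K (Suc l) * cnj (K l))) > 0"
    using Suc by (simp add: c_def)
  ultimately show ?case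
    by (simp add: add_nonneg_pos)
qed

text \<open>A confluent Christoffel-Darboux argument: each step adds a square to a positive multiple
  of the previous Wronskian.\<close>

lemma principal_minor_Wronskian_pos:
  assumes "\<And>j. p < j \<Longrightarrow> j \<le> p + l \<Longrightarrow> subdiag_entry R j * superdiag_entry R (j - 1) > 0"
  defines "K \<equiv> principal_minor R p"
  shows "poly (pderiv (K (Suc l)) * K l - K (Suc l) * pderiv (K l)) x > 0"
  using assms(1)
proof (induction l)
  case 0
  show ?case by (simp add: K_def principal_minor_def pderiv_pCons)
next
  case (Suc l)
  define b c where "b = diag_entry R (p + l + 1)"
    and "c = subdiag_entry R (p + l + 1) * superdiag_entry R (p + l)"
  have rec: "K (Suc (Suc l)) = [:b, 1:] * K (Suc l) - [:c:] * K l"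
    by (simp add: K_def principal_minor_def b_def c_def)
  have "pderiv (K (Suc (Suc l))) * K (Suc l) - K (Suc (Suc l)) * pderiv (K (Suc l)) =
      (K (Suc l))\<^sup>2 + [:c:] * (pderiv (K (Suc l)) * K l - K (Suc l) * pderiv (K l))"
    unfolding rec pderiv_diff pderiv_mult
    by (simp add: pderiv_pCons power2_eq_square algebra_simps smult_diff_right smult_add_right)
  moreover have "c * poly (pderiv (K (Suc l)) * K l - K (Suc l) * pderiv (K l)) x > 0"
    using Suc Suc.prems[of "p + l + 1"] by (intro mult_pos_pos) (auto simp: c_def)
  ultimately show ?case
    by (simp add: add_nonneg_pos)
qed

interpretation of_real_poly_hom: map_poly_inj_idom_hom "of_real :: real \<Rightarrow> complex" ..

lemma poly_of_real_principal_minor: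
  "poly (map_poly complex_of_real (principal_minor R p l)) z =
     continuant (\<lambda>j. z + of_real (diag_entry R j))
       (\<lambda>j. of_real (subdiag_entry R j * superdiag_entry R (j - 1))) p l"
  by (induction l rule: induct_nat_012)
    (simp_all add: principal_minor_def hom_distribs algebra_simps)

lemma principal_minor_zeros_real_simple:
  assumes pos: "\<And>j. p < j \<Longrightarrow> j < p + l \<Longrightarrow> subdiag_entry R j * superdiag_entry R (j - 1) > 0"
  shows "zeros_real_simple (principal_minor R p l)"
proof (cases l)
  case 0
  then show ?thesis by (simp add: principal_minor_def zeros_real_simple_def)
next
  case (Suc m)
  let ?p = "principal_minor R p l"
  let ?P = "map_poly complex_of_real ?p"
  have "?P \<noteq> 0" using principal_minor_nonzero by (simp add: map_poly_eq_0_iff)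
  have real: "z \<in> \<real>" if "poly ?P z = 0" for z
  proof (rule ccontr)
    assume "z \<notin> \<real>"
    then have "Im z \<noteq> 0" by (simp add: complex_is_Real_iff)
    from Im_continuant_pos[OF this, of p m "\<lambda>j. subdiag_entry R j * superdiag_entry R (j - 1)"
        "diag_entry R"] that pos Suc
    show False by (simp add: poly_of_real_principal_minor)
  qed
  have "order z ?P = 1" if z: "poly ?P z = 0" for z
  proof -
    from real[OF z] obtain x where x: "z = of_real x" by (auto elim: Reals_cases)
    have "poly ?p x = 0" using z by (simp add: x)
    \<comment> \<open>At a zero of \<open>?p\<close> the Wronskian reduces to its first product, so
      the derivative cannot vanish.\<close>
    with principal_minor_Wronskian_pos[of p m R x] pos Suc have "poly (pderiv ?p) x \<noteq> 0"
      by auto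
    then have "poly (pderiv ?P) z \<noteq> 0"
      by (simp add: x flip: of_real_hom.map_poly_pderiv)
    then show ?thesis
      using order_pderiv[OF \<open>?P \<noteq> 0\<close> z] by (simp add: order_0I)
  qed
  with real \<open>?P \<noteq> 0\<close> show ?thesis
    by (simp add: zeros_real_simple_def)
qed

lemma zeros_real_simple_uminus:
  "zeros_real_simple (- p) \<longleftrightarrow> zeros_real_simple p"
  by (simp add: zeros_real_simple_def Let_def of_real_poly_hom.hom_uminus)

theorem theorem4p1:
  fixes k n m :: nat and B R :: "real mat"
  assumes "k \<ge> 1" and "n = 2 ^ k - 1"
    and "B \<in> carrier_mat m m" and "symmetric_positive_definite B" and "tridiagonal_mat B"
    and "R \<in> carrier_mat n n" and "symmetric_positive_definite R" and "tridiagonal_mat R"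
    and "\<forall>i \<in> {2..n}. subdiag_entry R i \<noteq> 0"
  shows "\<forall>r \<in> {0..k - 1}. \<forall>i \<in> (\<lambda>l. l * 2 ^ r) ` {1..2 ^ (k - r) - 1}.
           \<exists>p. B_scalar R r i = to_fract p \<and> zeros_real_simple p"
proof (intro ballI, elim imageE)
  fix r i l :: nat
  assume r: "r \<in> {0..k - 1}" and i: "i = l * 2 ^ r" and l: "l \<in> {1..2 ^ (k - r) - 1}"
  have "2 ^ r \<le> i" using l by (simp add: i)
  have "Suc l * 2 ^ r \<le> 2 ^ (k - r) * 2 ^ r" using l by (intro mult_right_mono) auto
  also have "\<dots> = 2 ^ k" using r assms(1) by (simp flip: power_add)
  finally have i_le: "i + 2 ^ r \<le> n + 1" using assms(2) by (simp add: i)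
  have pos: "subdiag_entry R j * superdiag_entry R (j - 1) > 0" if "2 \<le> j" "j \<le> n" for j
  proof -
    have "R $$ (j - 2, j - 1) = R\<^sup>T $$ (j - 1, j - 2)"
      using that assms(6) by simp
    also have "R\<^sup>T = R" using assms(7) by (simp add: symmetric_positive_definite_def)
    \<comment> \<open>Since \<open>2 \<le> j\<close> and \<open>j \<le> n\<close>, neither entry is
      a default 0 at the border, and the product is a non-zero square.\<close>
    finally have "superdiag_entry R (j - 1) = subdiag_entry R j"
      using that assms(6) by (simp add: superdiag_entry_def subdiag_entry_def numeral_2_eq_2)
    moreover have "subdiag_entry R j \<noteq> 0" using that assms(9) by simp
    ultimately show ?thesis by (auto simp: zero_less_mult_iff linorder_neq_iff)
  qed
  let ?p = "principal_minor R (i + 1 - 2 ^ r) (2 ^ Suc r - 1)"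
  \<comment> \<open>The window ends at \<open>i + 2 ^ r - 1\<close>, which is at most
    \<open>n\<close>, and starts at 1 or later, so its inner links lie between 2 and
    \<open>n\<close>.\<close>
  have "zeros_real_simple ?p"
    using i_le \<open>2 ^ r \<le> i\<close> by (intro principal_minor_zeros_real_simple pos) auto
  then have "zeros_real_simple ((-1) ^ r * ?p)"
    by (cases "even r") (simp_all add: zeros_real_simple_uminus)
  moreover have "B_scalar R r i = to_fract ((-1) ^ r * ?p)"
    using Brec_eq_principal_minor[OF \<open>2 ^ r \<le> i\<close>] by (simp add: B_scalar_def)
  ultimately show "\<exists>p. B_scalar R r i = to_fract p \<and> zeros_real_simple p"
    by blast
qed

end
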